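(* Let $\theta$ be a measure preserving transformation of a measure space $(X,\Sigma,\nu)$. Let $f\in L^2(\nu)$ and $\delta>1$ be such that $$\sum_{n\ge 3}\frac{\log n\,(\log\log n)^\delta\,\big\|\sum_{k=1}^nf\circ\theta^k\big\|_{L^2(\nu)}^2}{n^2}<+\infty .$$ Then $$\frac{1}{\sqrt n}\sum_{k=1}^nf\circ\theta^k\longrightarrow 0\qquad\nu\text{-a.s. as } n\to+\infty,$$ and the series $\sum_{n\ge1}\frac{f\circ\theta^n}{\sqrt n}$ converges $\nu$-a.s. *)

theory Defs
  imports "HOL-Analysis.Analysis"
begin

definition measure_preserving_map :: "'a measure \<Rightarrow> ('a \<Rightarrow> 'a) \<Rightarrow> bool" where
  "measure_preserving_map M \<theta> \<longleftrightarrow>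
     \<theta> \<in> M \<rightarrow>\<^sub>M M \<and> (\<forall>A\<in>sets M. emeasure M (\<theta> -` A \<inter> space M) = emeasure M A)"

text \<open>Elements of \<open>L\<^sup>2\<close> are handled through measurable representatives, not through classes
  modulo null sets.\<close>

definition in_L2 :: "'a measure \<Rightarrow> ('a \<Rightarrow> 'b::euclidean_space) \<Rightarrow> bool" where
  "in_L2 M f \<longleftrightarrow> f \<in> borel_measurable M \<and> integrable M (\<lambda>x. (norm (f x))\<^sup>2)"

text \<open>Only meaningful under \<^const>\<open>in_L2\<close>: the Bochner integral of a non-integrable function is 0.\<close>

definition L2_norm :: "'a measure \<Rightarrow> ('a \<Rightarrow> 'b::euclidean_space) \<Rightarrow> real" where
  "L2_norm M f = sqrt (\<integral>x. (norm (f x))\<^sup>2 \<partial>M)"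

definition orbit_sum :: "('a \<Rightarrow> 'a) \<Rightarrow> ('a \<Rightarrow> 'b::euclidean_space) \<Rightarrow> nat \<Rightarrow> 'a \<Rightarrow> 'b" where
  "orbit_sum \<theta> f n x = (\<Sum>k=1..n. f ((\<theta> ^^ k) x))"

end

theory Submission
  imports Defs
begin

text \<open>Write \<open>S n\<close> for \<open>orbit_sum \<theta> f n\<close> and \<open>w n = ln n * (ln (ln n)) powr \<delta>\<close>. The hypothesis on \<open>\<delta>\<close>
  serves to make \<open>\<Sum> 1 / (n * w n)\<close> converge, and with it the dyadic series of the \<open>1 / w (2 ^ j)\<close>.

  For the first limit, the binary expansion of \<open>n\<close> cuts \<open>S n\<close> into at most one block
  \<open>S (2 ^ j) \<circ> \<theta> ^^ (i * 2 ^ j)\<close> for each \<open>j\<close>, with \<open>(i + 1) * 2 ^ j \<le> n\<close>. So \<open>norm (S n) / sqrt n\<close> is at most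
  a sum over \<open>j\<close> of terms from the sequences
  \<open>Y j i = norm (S (2 ^ j) \<circ> \<theta> ^^ (i * 2 ^ j)) / sqrt ((i + 1) * 2 ^ j)\<close>. Along almost every orbit of a map that
  preserves the measure, a square integrable \<open>h\<close> satisfies \<open>h (T ^^ i x) / sqrt i \<longlonglongrightarrow> 0\<close>, hence each
  \<open>Y j\<close> tends to 0 almost everywhere. It remains to dominate \<open>Sup (range (Y j))\<close> by a summable sequence
  in \<open>j\<close> and to apply Tannery's theorem (\<open>dyadic_chaining_tendsto_0\<close>). For any threshold \<open>\<epsilon> > 0\<close> the
  supremum is at most \<open>\<epsilon>\<close> plus the sum of all \<open>Y j i\<close> that exceed \<open>\<epsilon>\<close>, and the integral of that sum is at most
  \<open>2 / \<epsilon>\<close> times the squared norm of \<open>S (2 ^ j) / sqrt (2 ^ j)\<close> (\<open>nn_integral_excess_le\<close>).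
  With \<open>\<epsilon> = 1 / w (2 ^ j)\<close> the thresholds are summable, and the integrals are summable because \<open>\<Sum> w (2 ^ j) * (L2_norm M (S (2 ^ j)))\<^sup>2 / 2 ^ j\<close> is at most a constant times the assumed
  series, apart from finitely many terms (\<open>summable_dyadic_L2_norm\<close>).

  For the series, summation by parts leaves the convergence of \<open>\<Sum> norm (S n) / n powr (3 / 2)\<close>. The general
  term is at most \<open>w n * (norm (S n))\<^sup>2 / n\<^sup>2 + 1 / (n * w n)\<close>; the first part is summable almost everywhere since
  its integrals sum to the assumed series, and the second by the choice of \<open>w\<close>.\<close>

section \<open>Summability of the weights\<close>

lemma summable_dyadic_blocks:
  fixes c :: "nat \<Rightarrow> real"
  assumes "summable c" and nonneg: "\<And>n. 0 \<le> c n"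
  shows "summable (\<lambda>j. \<Sum>n\<in>{2^j..<2^Suc j}. c n)"
proof (rule summableI_nonneg_bounded)
  fix J
  have "(\<Sum>j<J. \<Sum>n\<in>{2^j..<2^Suc j}. c n) = (\<Sum>n\<in>{1..<2^J}. c n)"
    by (induction J) (simp_all add: sum.atLeastLessThan_concat)
  also have "\<dots> \<le> suminf c"
    using assms by (intro sum_le_suminf) auto
  finally show "(\<Sum>j<J. \<Sum>n\<in>{2^j..<2^Suc j}. c n) \<le> suminf c" .
qed (auto intro: sum_nonneg nonneg)

definition log_weight :: "real \<Rightarrow> nat \<Rightarrow> real" where
  "log_weight \<delta> n = ln (real n) * (ln (ln (real n))) powr \<delta>"

lemma one_less_ln_3: "1 < ln (3::real)"
proof -
  have "exp 1 < (3::real)" using e_less_272 by simp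
  then show ?thesis by (metis exp_less_cancel_iff exp_ln zero_less_numeral)
qed

lemma ln_ln_pos: "x \<ge> (3::real) \<Longrightarrow> 0 < ln (ln x)"
  using one_less_ln_3 ln_mono[of 3 x] by (intro ln_gt_zero) linarith

lemma log_weight_pos: "n \<ge> 3 \<Longrightarrow> 0 < log_weight \<delta> n"
  using ln_ln_pos[of "real n"] by (auto simp: log_weight_def)

lemma log_weight_nonneg: "0 \<le> log_weight \<delta> n"
  by (cases "n = 0") (auto simp: log_weight_def)

lemma log_weight_mono:
  assumes "3 \<le> m" "m \<le> n" "0 \<le> \<delta>"
  shows "log_weight \<delta> m \<le> log_weight \<delta> n"
proof -
  have "1 < ln (real m)"
    using one_less_ln_3 assms by (metis ln_mono less_le_trans of_nat_mono of_nat_numeral zero_less_numeral)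
  moreover have "ln (real m) \<le> ln (real n)" using assms by simp
  ultimately show ?thesis
    using assms ln_ln_pos[of "real m"] unfolding log_weight_def
    by (intro mult_mono powr_mono2) auto
qed

text \<open>By the mean value theorem, \<open>\<delta> - 1\<close> times the term at \<open>n + 1\<close> is at most the decrease of
  \<open>(ln (ln x)) powr (1 - \<delta>)\<close> from \<open>n\<close> to \<open>n + 1\<close>, and these decreases telescope to a function that
  vanishes at infinity.\<close>

lemma summable_inverse_log_weight:
  assumes "\<delta> > 1"
  shows "summable (\<lambda>n. 1 / (real n * log_weight \<delta> n))"
proof -
  define g where "g = (\<lambda>x::real. ln (ln x) powr (1 - \<delta>))"
  have deriv: "(g has_real_derivative - ((\<delta> - 1) / (x * (ln x * ln (ln x) powr \<delta>)))) (at x)"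
    if "x \<ge> 3" for x
  proof -
    have "0 < ln x" "0 < ln (ln x)"
      using that ln_ln_pos by auto
    moreover have "ln (ln x) powr (- \<delta>) = 1 / ln (ln x) powr \<delta>"
      by (simp add: powr_minus divide_simps)
    ultimately show ?thesis
      unfolding g_def using that
      by (auto intro!: derivative_eq_intros simp: divide_simps)
  qed
  have step: "(\<delta> - 1) * (1 / (real (Suc n) * log_weight \<delta> (Suc n))) \<le> g (real n) - g (real (Suc n))"
    if n: "n \<ge> 3" for n
  proof -
    obtain z where z: "real n < z" "z < real (Suc n)"
      and eq: "g (real (Suc n)) - g (real n)
        = (real (Suc n) - real n) * - ((\<delta> - 1) / (z * (ln z * ln (ln z) powr \<delta>)))"
      using MVT2[of "real n" "real (Suc n)" g, OF _ deriv] n by auto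
    have "0 < ln z" "0 < ln (ln z)" using z n ln_ln_pos[of z] by auto
    moreover from this have "ln (ln z) \<le> ln (ln (real (Suc n)))" "ln z \<le> ln (real (Suc n))"
      using z n by auto
    ultimately have "z * (ln z * ln (ln z) powr \<delta>) \<le> real (Suc n) * log_weight \<delta> (Suc n)"
      unfolding log_weight_def using z n \<open>\<delta> > 1\<close>
      by (intro mult_mono powr_mono2) auto
    moreover have "0 < z * (ln z * ln (ln z) powr \<delta>)"
      using z n \<open>0 < ln z\<close> \<open>0 < ln (ln z)\<close> by auto
    ultimately have "(\<delta> - 1) / (real (Suc n) * log_weight \<delta> (Suc n))
        \<le> (\<delta> - 1) / (z * (ln z * ln (ln z) powr \<delta>))"
      using \<open>\<delta> > 1\<close> by (intro divide_left_mono) auto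
    with eq show ?thesis by simp
  qed
  have "filterlim (\<lambda>n. ln (ln (real n))) at_top sequentially"
    by (intro filterlim_compose[OF ln_at_top] filterlim_real_sequentially)
  then have "(\<lambda>n. g (real n)) \<longlonglongrightarrow> 0"
    unfolding g_def using \<open>\<delta> > 1\<close> by (intro tendsto_neg_powr) auto
  then have "summable (\<lambda>n. g (real n) - g (real (Suc n)))"
    by (rule telescope_summable')
  then have "summable (\<lambda>n. (\<delta> - 1) * (1 / (real (Suc n) * log_weight \<delta> (Suc n))))"
    by (rule summable_comparison_test'[where N = 3])
       (use step \<open>\<delta> > 1\<close> in \<open>auto simp: log_weight_nonneg simp del: of_nat_Suc\<close>)
  then have "summable (\<lambda>n. 1 / (real (Suc n) * log_weight \<delta> (Suc n)))"
    by (subst (asm) summable_cmult_iff) (use \<open>\<delta> > 1\<close> in auto)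
  then show ?thesis by (subst (asm) summable_Suc_iff)
qed

text \<open>Over the dyadic block below \<open>2 ^ Suc j\<close>, the terms \<open>1 / (n * log_weight \<delta> n)\<close> are at least as large as at
  its right end, so their sum is at least half of the term here. This gives summability from that of
  the full series.\<close>

lemma summable_inverse_log_weight_dyadic:
  assumes "\<delta> > 1"
  shows "summable (\<lambda>j. 1 / log_weight \<delta> (2 ^ j))"
proof -
  let ?u = "\<lambda>n. 1 / (real n * log_weight \<delta> n)"
  have "summable (\<lambda>j. 2 * (\<Sum>n\<in>{2^j..<2^Suc j}. ?u n))"
    by (intro summable_mult summable_dyadic_blocks summable_inverse_log_weight assms)
       (auto simp: log_weight_nonneg)
  moreover have "norm (1 / log_weight \<delta> (2 ^ Suc j)) \<le> 2 * (\<Sum>n\<in>{2^j..<2^Suc j}. ?u n)"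
    if "j \<ge> 2" for j
  proof -
    have four: "(4::nat) \<le> 2 ^ j" using power_increasing[OF that, of "2::nat"] by simp
    have "(\<Sum>n\<in>{2^j..<2^Suc j::nat}. ?u (2 ^ Suc j)) \<le> (\<Sum>n\<in>{2^j..<2^Suc j}. ?u n)"
    proof (rule sum_mono)
      fix n :: nat assume n: "n \<in> {2^j..<2^Suc j}"
      then have "log_weight \<delta> n \<le> log_weight \<delta> (2 ^ Suc j)" "0 < log_weight \<delta> n" "0 < real n"
        "real n \<le> real (2 ^ Suc j)"
        using four assms by (auto intro!: log_weight_mono log_weight_pos simp del: power_Suc)
      then show "?u (2 ^ Suc j) \<le> ?u n"
        by (intro divide_left_mono mult_mono mult_pos_pos) auto
    qed
    then show ?thesis
      by (simp add: log_weight_nonneg field_simps)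
  qed
  ultimately have "summable (\<lambda>j. 1 / log_weight \<delta> (2 ^ Suc j))"
    by (rule summable_comparison_test'[where N = 2])
  then show ?thesis by (subst (asm) summable_Suc_iff)
qed

section \<open>Square integrable functions along orbits\<close>

lemma measure_preserving_map_funpow:
  assumes "measure_preserving_map M \<theta>"
  shows "measure_preserving_map M (\<theta> ^^ n)"
proof (induction n)
  case 0
  show ?case by (auto simp: measure_preserving_map_def intro!: arg_cong[where f = "emeasure M"] dest: sets.sets_into_space)
next
  case (Suc n)
  have [measurable]: "\<theta> \<in> M \<rightarrow>\<^sub>M M" "\<theta> ^^ n \<in> M \<rightarrow>\<^sub>M M"
    using assms Suc by (auto simp: measure_preserving_map_def)
  have "emeasure M ((\<theta> ^^ Suc n) -` A \<inter> space M) = emeasure M A" if [measurable]: "A \<in> sets M" for A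
  proof -
    have "(\<theta> ^^ Suc n) -` A \<inter> space M = (\<theta> ^^ n) -` (\<theta> -` A \<inter> space M) \<inter> space M"
      using measurable_space[OF \<open>\<theta> ^^ n \<in> M \<rightarrow>\<^sub>M M\<close>] by auto
    moreover have "\<theta> -` A \<inter> space M \<in> sets M" by measurable
    ultimately have "emeasure M ((\<theta> ^^ Suc n) -` A \<inter> space M) = emeasure M (\<theta> -` A \<inter> space M)"
      using Suc by (metis measure_preserving_map_def)
    also have "\<dots> = emeasure M A"
      using assms that by (simp add: measure_preserving_map_def)
    finally show ?thesis .
  qed
  moreover have "\<theta> ^^ Suc n \<in> M \<rightarrow>\<^sub>M M"
    by (simp add: comp_def)
  ultimately show ?case unfolding measure_preserving_map_def by blast
qed

lemma measurable_measure_preserving_map: "measure_preserving_map M \<theta> \<Longrightarrow> \<theta> \<in> M \<rightarrow>\<^sub>M M"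
  by (simp add: measure_preserving_map_def)

lemma nn_integral_measure_preserving_map:
  assumes "measure_preserving_map M \<theta>" and [measurable]: "g \<in> borel_measurable M"
  shows "(\<integral>\<^sup>+x. g (\<theta> x) \<partial>M) = (\<integral>\<^sup>+x. g x \<partial>M)"
proof -
  note [measurable] = measurable_measure_preserving_map[OF assms(1)]
  have "distr M M \<theta> = M"
    using assms by (intro measure_eqI) (auto simp: emeasure_distr measure_preserving_map_def)
  then show ?thesis
    using nn_integral_distr[of \<theta> M M g] by simp
qed

lemma in_L2_iff:
  "in_L2 M f \<longleftrightarrow> f \<in> borel_measurable M \<and> (\<integral>\<^sup>+x. ennreal ((norm (f x))\<^sup>2) \<partial>M) < \<infinity>"
  by (auto simp: in_L2_def integrable_iff_bounded)

lemma borel_measurable_in_L2: "in_L2 M f \<Longrightarrow> f \<in> borel_measurable M"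
  by (simp add: in_L2_def)

lemma nn_integral_norm_square:
  assumes "in_L2 M f"
  shows "(\<integral>\<^sup>+x. ennreal ((norm (f x))\<^sup>2) \<partial>M) = ennreal ((L2_norm M f)\<^sup>2)"
  using assms by (simp add: in_L2_def L2_norm_def nn_integral_eq_integral)

lemma in_L2_add:
  assumes "in_L2 M f" "in_L2 M g"
  shows "in_L2 M (\<lambda>x. f x + g x)"
  unfolding in_L2_def
proof
  have [measurable]: "f \<in> borel_measurable M" "g \<in> borel_measurable M"
    using assms by (auto simp: in_L2_def)
  show "(\<lambda>x. f x + g x) \<in> borel_measurable M" by measurable
  have le: "(norm (f x + g x))\<^sup>2 \<le> 2 * (norm (f x))\<^sup>2 + 2 * (norm (g x))\<^sup>2" for x
    using power_mono[OF norm_triangle_ineq norm_ge_zero, of "f x" "g x" 2]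
      zero_le_power2[of "norm (f x) - norm (g x)"]
    by (simp add: power2_eq_square algebra_simps)
  show "integrable M (\<lambda>x. (norm (f x + g x))\<^sup>2)"
  proof (rule Bochner_Integration.integrable_bound)
    show "integrable M (\<lambda>x. 2 * (norm (f x))\<^sup>2 + 2 * (norm (g x))\<^sup>2)"
      using assms by (simp add: in_L2_def)
    show "AE x in M. norm ((norm (f x + g x))\<^sup>2) \<le> norm (2 * (norm (f x))\<^sup>2 + 2 * (norm (g x))\<^sup>2)"
      using le by (intro AE_I2) simp
  qed measurable
qed

lemma in_L2_scaleR: "in_L2 M f \<Longrightarrow> in_L2 M (\<lambda>x. c *\<^sub>R f x)"
  by (auto simp: in_L2_def power_mult_distrib)

lemma L2_norm_scaleR_square: "(L2_norm M (\<lambda>x. c *\<^sub>R f x))\<^sup>2 = c\<^sup>2 * (L2_norm M f)\<^sup>2"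
  by (simp add: L2_norm_def power_mult_distrib)

lemma L2_norm_diff_square_le:
  assumes "in_L2 M f" "in_L2 M g"
  shows "(L2_norm M (\<lambda>x. f x - g x))\<^sup>2 \<le> 2 * (L2_norm M f)\<^sup>2 + 2 * (L2_norm M g)\<^sup>2"
proof -
  have "in_L2 M (\<lambda>x. f x - g x)"
    using in_L2_add[OF assms(1) in_L2_scaleR[OF assms(2), of "-1"]] by simp
  moreover have "(norm (f x - g x))\<^sup>2 \<le> 2 * (norm (f x))\<^sup>2 + 2 * (norm (g x))\<^sup>2" for x
    using power_mono[OF norm_triangle_ineq4 norm_ge_zero, of "f x" "g x" 2]
      zero_le_power2[of "norm (f x) - norm (g x)"]
    by (simp add: power2_eq_square algebra_simps)
  ultimately have "(\<integral>x. (norm (f x - g x))\<^sup>2 \<partial>M) \<le> (\<integral>x. 2 * (norm (f x))\<^sup>2 + 2 * (norm (g x))\<^sup>2 \<partial>M)"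
    using assms by (intro integral_mono) (auto simp: in_L2_def)
  also have "\<dots> = 2 * (\<integral>x. (norm (f x))\<^sup>2 \<partial>M) + 2 * (\<integral>x. (norm (g x))\<^sup>2 \<partial>M)"
    using assms by (subst Bochner_Integration.integral_add) (auto simp: in_L2_def)
  finally show ?thesis by (simp add: L2_norm_def)
qed

lemma
  assumes "measure_preserving_map M \<theta>" "in_L2 M f"
  shows in_L2_measure_preserving: "in_L2 M (\<lambda>x. f (\<theta> x))"
    and L2_norm_measure_preserving: "L2_norm M (\<lambda>x. f (\<theta> x)) = L2_norm M f"
proof -
  note [measurable] = measurable_measure_preserving_map[OF assms(1)] borel_measurable_in_L2[OF assms(2)]
  have eq: "(\<integral>\<^sup>+x. ennreal ((norm (f (\<theta> x)))\<^sup>2) \<partial>M) = (\<integral>\<^sup>+x. ennreal ((norm (f x))\<^sup>2) \<partial>M)"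
    by (rule nn_integral_measure_preserving_map[OF assms(1)]) measurable
  have meas: "(\<lambda>x. f (\<theta> x)) \<in> borel_measurable M" by measurable
  show *: "in_L2 M (\<lambda>x. f (\<theta> x))"
    using assms(2) meas by (simp add: in_L2_iff eq)
  show "L2_norm M (\<lambda>x. f (\<theta> x)) = L2_norm M f"
    using eq unfolding nn_integral_norm_square[OF *] nn_integral_norm_square[OF assms(2)]
    by (simp add: L2_norm_def)
qed

lemma in_L2_orbit_sum:
  assumes "measure_preserving_map M \<theta>" "in_L2 M f"
  shows "in_L2 M (orbit_sum \<theta> f n)"
proof (induction n)
  case 0
  show ?case by (simp add: orbit_sum_def in_L2_def)
next
  case (Suc n)
  then show ?case
    using in_L2_add[OF Suc in_L2_measure_preserving[OF measure_preserving_map_funpow[OF assms(1)] assms(2)], of "Suc n"]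
    by (simp add: orbit_sum_def[abs_def])
qed

lemma orbit_sum_shift:
  "orbit_sum \<theta> f m ((\<theta> ^^ n) x) = orbit_sum \<theta> f (n + m) x - orbit_sum \<theta> f n x"
proof (induction m)
  case (Suc m)
  have "(\<theta> ^^ Suc m) ((\<theta> ^^ n) x) = (\<theta> ^^ Suc (n + m)) x"
    by (metis add.commute add_Suc_right comp_apply funpow_add)
  with Suc show ?case by (simp add: orbit_sum_def del: funpow.simps)
qed (simp add: orbit_sum_def)

text \<open>The sum of \<open>m\<close> terms that starts at time \<open>n\<close> has the same norm as the one that starts at time 0,
  and it is the difference of two orbit sums. The free choice of \<open>n\<close> allows averaging.\<close>

lemma L2_norm_orbit_sum_shift:
  assumes "measure_preserving_map M \<theta>" "in_L2 M f"
  shows "(L2_norm M (orbit_sum \<theta> f m))\<^sup>2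
    \<le> 2 * (L2_norm M (orbit_sum \<theta> f n))\<^sup>2 + 2 * (L2_norm M (orbit_sum \<theta> f (n + m)))\<^sup>2"
proof -
  have "L2_norm M (orbit_sum \<theta> f m) = L2_norm M (\<lambda>x. orbit_sum \<theta> f m ((\<theta> ^^ n) x))"
    using assms by (intro L2_norm_measure_preserving[symmetric] measure_preserving_map_funpow in_L2_orbit_sum)
  also have "\<dots> = L2_norm M (\<lambda>x. orbit_sum \<theta> f (n + m) x - orbit_sum \<theta> f n x)"
    by (simp add: orbit_sum_shift)
  finally show ?thesis
    using L2_norm_diff_square_le[OF in_L2_orbit_sum[OF assms] in_L2_orbit_sum[OF assms], of "n + m" n]
    by simp
qed

text \<open>The previous lemma with \<open>m = 2 ^ j\<close>, averaged over \<open>n\<close> from \<open>2 ^ j\<close> to \<open>2 ^ Suc j\<close>, bounds the term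
  at \<open>j\<close> by the part of the full series over \<open>2 ^ j \<le> n < 3 * 2 ^ j\<close>. This range lies in two consecutive
  dyadic blocks, so each index is used at most twice.\<close>

lemma summable_dyadic_L2_norm:
  fixes w :: "nat \<Rightarrow> real"
  assumes mp: "measure_preserving_map M \<theta>" and L2: "in_L2 M f"
    and w: "\<And>n. 0 \<le> w n" and mono: "\<And>m n. N \<le> m \<Longrightarrow> m \<le> n \<Longrightarrow> w m \<le> w n"
    and sum: "summable (\<lambda>n. w n * (L2_norm M (orbit_sum \<theta> f n))\<^sup>2 / (real n)\<^sup>2)"
  shows "summable (\<lambda>j. w (2 ^ j) * ((L2_norm M (orbit_sum \<theta> f (2 ^ j)))\<^sup>2 / 2 ^ j))"
proof -
  define a where "a n = (L2_norm M (orbit_sum \<theta> f n))\<^sup>2" for n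
  define c where "c n = w n * a n / (real n)\<^sup>2" for n
  define B where "B j = (\<Sum>n\<in>{2^j..<2^Suc j}. c n)" for j
  have c: "0 \<le> c n" and a: "0 \<le> a n" for n by (auto simp: c_def a_def w)
  have four: "2 ^ j * 2 ^ j = (4 ^ j :: real)" for j :: nat
    by (metis mult_2_right numeral_Bit0 power_mult_distrib)
  have B: "summable B"
    unfolding B_def using sum c by (intro summable_dyadic_blocks) (auto simp: c_def a_def)
  have "summable (\<lambda>j. 32 * (B j + B (Suc j)))"
    using B by (intro summable_mult summable_add) (auto simp: summable_Suc_iff)
  moreover have "norm (w (2 ^ j) * (a (2 ^ j) / 2 ^ j)) \<le> 32 * (B j + B (Suc j))" if "j \<ge> N" for j
  proof -
    have Nj: "N \<le> 2 ^ j" using that less_exp[of j] by linarith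
    \<comment> \<open>In this range \<open>n\<^sup>2\<close> is below \<open>16 * 4 ^ j\<close>; together with \<open>w (2 ^ j) \<le> w n\<close> this inserts the factor
      \<open>1 / n\<^sup>2\<close> of \<open>c n\<close>.\<close>
    have term_le: "w (2 ^ j) * a n \<le> 16 * 4 ^ j * c n" if "n \<in> {2^j..<4 * 2^j}" for n
    proof -
      have "real n \<le> real (4 * 2 ^ j)"
        using that by (intro of_nat_mono) auto
      then have "(real n)\<^sup>2 \<le> (4 * 2 ^ j)\<^sup>2"
        by (intro power_mono) auto
      also have "(4 * 2 ^ j)\<^sup>2 = 16 * (4 ^ j :: real)"
        by (simp add: power_mult_distrib power2_eq_square four)
      finally have n: "(real n)\<^sup>2 \<le> 16 * 4 ^ j" .
      have "0 < n" using that by (auto intro: Nat.gr0I)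
      have "w (2 ^ j) * a n \<le> w n * a n"
        using that Nj a by (intro mult_right_mono mono) auto
      also have "\<dots> = (real n)\<^sup>2 * c n" using \<open>0 < n\<close> by (simp add: c_def)
      also have "\<dots> \<le> 16 * 4 ^ j * c n" using n c by (intro mult_right_mono) auto
      finally show ?thesis .
    qed
    have "2 ^ j * (w (2 ^ j) * a (2 ^ j)) = (\<Sum>n\<in>{2^j..<2^Suc j::nat}. w (2 ^ j) * a (2 ^ j))"
      by simp
    also have "\<dots> \<le> (\<Sum>n\<in>{2^j..<2^Suc j}. 32 * 4 ^ j * c n + 32 * 4 ^ j * c (n + 2 ^ j))"
    proof (rule sum_mono)
      fix n :: nat assume n: "n \<in> {2^j..<2^Suc j}"
      have "w (2 ^ j) * a (2 ^ j) \<le> w (2 ^ j) * (2 * a n + 2 * a (n + 2 ^ j))"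
        unfolding a_def by (intro mult_left_mono L2_norm_orbit_sum_shift mp L2 w)
      also have "\<dots> \<le> 32 * 4 ^ j * c n + 32 * 4 ^ j * c (n + 2 ^ j)"
        using term_le[of n] term_le[of "n + 2 ^ j"] n by (simp add: algebra_simps)
      finally show "w (2 ^ j) * a (2 ^ j) \<le> 32 * 4 ^ j * c n + 32 * 4 ^ j * c (n + 2 ^ j)" .
    qed
    also have "\<dots> = 32 * 4 ^ j * (B j + (\<Sum>n\<in>{2^j..<2^Suc j}. c (n + 2 ^ j)))"
      by (simp add: B_def sum.distrib sum_distrib_left algebra_simps)
    also have "(\<Sum>n\<in>{2^j..<2^Suc j}. c (n + 2 ^ j)) = (\<Sum>n\<in>{2^j + 2^j..<2^Suc j + 2^j::nat}. c n)"
      by (rule sum.shift_bounds_nat_ivl[symmetric])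
    also have "\<dots> \<le> B (Suc j)"
      unfolding B_def by (intro sum_mono2) (auto intro: c)
    finally have "2 ^ j * (w (2 ^ j) * a (2 ^ j)) \<le> 32 * (2 ^ j * 2 ^ j) * (B j + B (Suc j))"
      by (simp add: mult_left_mono four)
    then have "w (2 ^ j) * a (2 ^ j) \<le> 32 * 2 ^ j * (B j + B (Suc j))"
      by (simp add: mult.assoc mult.left_commute)
    then show ?thesis using w a by (simp add: field_simps abs_mult)
  qed
  ultimately show ?thesis
    unfolding a_def[symmetric] by (rule summable_comparison_test'[where N = N])
qed

section \<open>Large values along one orbit\<close>

lemma AE_suminf_finite:
  fixes g :: "nat \<Rightarrow> 'a \<Rightarrow> ennreal"
  assumes [measurable]: "\<And>n. g n \<in> borel_measurable M"
    and le: "\<And>n. (\<integral>\<^sup>+x. g n x \<partial>M) \<le> ennreal (c n)"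
    and c: "summable c" "\<And>n. 0 \<le> c n"
  shows "AE x in M. (\<Sum>n. g n x) \<noteq> \<infinity>"
proof (rule nn_integral_PInf_AE)
  have "(\<integral>\<^sup>+x. (\<Sum>n. g n x) \<partial>M) = (\<Sum>n. \<integral>\<^sup>+x. g n x \<partial>M)"
    by (rule nn_integral_suminf) measurable
  also have "\<dots> \<le> (\<Sum>n. ennreal (c n))"
    by (intro suminf_le le) auto
  also have "\<dots> = ennreal (suminf c)"
    using c by (intro suminf_ennreal2) auto
  finally show "(\<integral>\<^sup>+x. (\<Sum>n. g n x) \<partial>M) \<noteq> \<infinity>"
    by (auto simp: top_unique)
qed measurable

text \<open>The total of those terms \<open>norm (h ((T ^^ i) x)) / sqrt (i + 1)\<close> that exceed \<open>\<epsilon>\<close>. It controls the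
  supremum of the sequence up to \<open>\<epsilon>\<close>, and unlike the supremum it can be integrated term by term.\<close>

definition excess :: "real \<Rightarrow> ('a \<Rightarrow> 'a) \<Rightarrow> ('a \<Rightarrow> 'b::euclidean_space) \<Rightarrow> 'a \<Rightarrow> ennreal" where
  "excess \<epsilon> T h x = (\<Sum>i. ennreal (if \<epsilon> * sqrt (real (Suc i)) < norm (h ((T ^^ i) x))
     then norm (h ((T ^^ i) x)) / sqrt (real (Suc i)) else 0))"

lemma le_excess:
  assumes "\<epsilon> > 0"
  shows "ennreal (norm (h ((T ^^ i) x)) / sqrt (real (Suc i))) \<le> ennreal \<epsilon> + excess \<epsilon> T h x"
proof (cases "\<epsilon> * sqrt (real (Suc i)) < norm (h ((T ^^ i) x))")
  case True
  define t where "t i = ennreal (if \<epsilon> * sqrt (real (Suc i)) < norm (h ((T ^^ i) x))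
    then norm (h ((T ^^ i) x)) / sqrt (real (Suc i)) else 0)" for i
  have "sum t {i} \<le> suminf t"
    by (rule sum_le_suminf) auto
  moreover have "excess \<epsilon> T h x = suminf t"
    unfolding excess_def t_def ..
  moreover have "t i = ennreal (norm (h ((T ^^ i) x)) / sqrt (real (Suc i)))"
    by (simp only: t_def True if_True)
  ultimately show ?thesis by (simp add: add_increasing)
next
  case False
  then have "norm (h ((T ^^ i) x)) / sqrt (real (Suc i)) \<le> \<epsilon>"
    by (subst pos_divide_le_eq) auto
  then have "ennreal (norm (h ((T ^^ i) x)) / sqrt (real (Suc i))) \<le> ennreal \<epsilon>"
    by (rule ennreal_leI)
  then show ?thesis by (simp add: add_increasing2)
qed

text \<open>The sum runs over \<open>i + 1 < min (N + 1) (r\<^sup>2)\<close> and is compared with \<open>\<integral> 1 / sqrt t\<close>. In the form of a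
  minimum, the bound is inductive in \<open>N\<close>.\<close>

lemma sum_inverse_sqrt_below:
  assumes "0 \<le> (r::real)"
  shows "(\<Sum>i<N. if sqrt (real (Suc i)) < r then 1 / sqrt (real (Suc i)) else 0)
    \<le> 2 * min (sqrt (real N)) r"
proof (induction N)
  case 0
  then show ?case using assms by simp
next
  case (Suc N)
  show ?case
  proof (cases "sqrt (real (Suc N)) < r")
    case True
    have "1 / sqrt (real (Suc N)) \<le> 2 * (sqrt (real (Suc N)) - sqrt (real N))"
    proof -
      have "sqrt (real N) * sqrt (real (Suc N)) \<le> (real N + real (Suc N)) / 2"
        by (rule arith_geo_mean_sqrt[of "real N" "real (Suc N)", unfolded real_sqrt_mult]) auto
      then show ?thesis
        by (simp add: field_simps)
    qed
    with Suc True show ?thesis by (simp del: of_nat_Suc)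
  next
    case False
    have "sqrt (real N) \<le> sqrt (real (Suc N))" by simp
    with Suc False show ?thesis by (simp del: of_nat_Suc real_sqrt_le_iff)
  qed
qed

text \<open>Since \<open>T ^^ i\<close> preserves the measure, each orbit value may be replaced by \<open>h x\<close> under the integral.
  For fixed \<open>t = norm (h x)\<close> the terms above the threshold are those with \<open>sqrt (i + 1) < t / \<epsilon>\<close>, and by
  the previous lemma they add up to at most \<open>2 * t\<^sup>2 / \<epsilon>\<close>.\<close>

lemma
  fixes h :: "'a \<Rightarrow> 'b::euclidean_space"
  assumes T: "measure_preserving_map M T" and h: "in_L2 M h" and "\<epsilon> > 0"
  shows borel_measurable_excess: "excess \<epsilon> T h \<in> borel_measurable M"
    and nn_integral_excess_le: "(\<integral>\<^sup>+x. excess \<epsilon> T h x \<partial>M) \<le> ennreal (2 * (L2_norm M h)\<^sup>2 / \<epsilon>)"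
proof -
  have [measurable]: "h \<in> borel_measurable M" "\<And>i. T ^^ i \<in> M \<rightarrow>\<^sub>M M"
    by (intro borel_measurable_in_L2 h measurable_measure_preserving_map measure_preserving_map_funpow T)+
  define \<phi> where "\<phi> i t = (if \<epsilon> * sqrt (real (Suc i)) < t then t / sqrt (real (Suc i)) else 0)" for i t
  have [measurable]: "\<phi> i \<in> borel_measurable borel" for i
    unfolding \<phi>_def by measurable
  have excess: "excess \<epsilon> T h = (\<lambda>x. \<Sum>i. ennreal (\<phi> i (norm (h ((T ^^ i) x)))))"
    by (auto simp: excess_def \<phi>_def)
  show "excess \<epsilon> T h \<in> borel_measurable M"
    unfolding excess by measurable
  have \<phi>_sum: "(\<Sum>i. ennreal (\<phi> i t)) \<le> ennreal (2 / \<epsilon>) * ennreal (t\<^sup>2)" if "t \<ge> 0" for t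
  proof (rule suminf_le_const)
    fix N
    have "\<phi> i t = t * (if sqrt (real (Suc i)) < t / \<epsilon> then 1 / sqrt (real (Suc i)) else 0)" for i
      using \<open>\<epsilon> > 0\<close> by (auto simp: \<phi>_def field_simps)
    then have "(\<Sum>i<N. \<phi> i t) = t * (\<Sum>i<N. if sqrt (real (Suc i)) < t / \<epsilon> then 1 / sqrt (real (Suc i)) else 0)"
      by (simp add: sum_distrib_left)
    also have "\<dots> \<le> t * (2 * (t / \<epsilon>))"
      using sum_inverse_sqrt_below[of "t / \<epsilon>" N] that \<open>\<epsilon> > 0\<close> by (intro mult_left_mono) auto
    also have "\<dots> = 2 / \<epsilon> * t\<^sup>2" by (simp add: power2_eq_square)
    finally have "ennreal (\<Sum>i<N. \<phi> i t) \<le> ennreal (2 / \<epsilon> * t\<^sup>2)" by (rule ennreal_leI)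
    then show "(\<Sum>i<N. ennreal (\<phi> i t)) \<le> ennreal (2 / \<epsilon>) * ennreal (t\<^sup>2)"
      using \<open>\<epsilon> > 0\<close> that by (simp add: \<phi>_def sum_ennreal ennreal_mult flip: ennreal_mult)
  qed auto
  have "(\<integral>\<^sup>+x. excess \<epsilon> T h x \<partial>M) = (\<Sum>i. \<integral>\<^sup>+x. ennreal (\<phi> i (norm (h ((T ^^ i) x)))) \<partial>M)"
    unfolding excess by (rule nn_integral_suminf) measurable
  also have "\<dots> = (\<Sum>i. \<integral>\<^sup>+x. ennreal (\<phi> i (norm (h x))) \<partial>M)"
    by (intro suminf_cong nn_integral_measure_preserving_map[OF measure_preserving_map_funpow[OF T],
          where g = "\<lambda>x. ennreal (\<phi> _ (norm (h x)))"]) measurable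
  also have "\<dots> = (\<integral>\<^sup>+x. (\<Sum>i. ennreal (\<phi> i (norm (h x)))) \<partial>M)"
    by (rule nn_integral_suminf[symmetric]) measurable
  also have "\<dots> \<le> (\<integral>\<^sup>+x. ennreal (2 / \<epsilon>) * ennreal ((norm (h x))\<^sup>2) \<partial>M)"
    by (intro nn_integral_mono \<phi>_sum) auto
  also have "\<dots> = ennreal (2 / \<epsilon>) * ennreal ((L2_norm M h)\<^sup>2)"
    by (subst nn_integral_cmult) (simp_all add: nn_integral_norm_square[OF h])
  also have "\<dots> = ennreal (2 * (L2_norm M h)\<^sup>2 / \<epsilon>)"
    using \<open>\<epsilon> > 0\<close> by (simp flip: ennreal_mult)
  finally show "(\<integral>\<^sup>+x. excess \<epsilon> T h x \<partial>M) \<le> ennreal (2 * (L2_norm M h)\<^sup>2 / \<epsilon>)" .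
qed

text \<open>Where the excess over \<open>\<epsilon>\<close> is finite, its terms tend to 0, so the sequence is eventually at most
  \<open>\<epsilon>\<close>. Countably many \<open>\<epsilon>\<close> suffice.\<close>

lemma AE_orbit_div_sqrt_tendsto_0:
  assumes T: "measure_preserving_map M T" and h: "in_L2 M h"
  shows "AE x in M. (\<lambda>i. norm (h ((T ^^ i) x)) / sqrt (real (Suc i))) \<longlonglongrightarrow> 0"
proof -
  have "AE x in M. excess (1 / real (Suc m)) T h x \<noteq> \<infinity>" for m
    using nn_integral_excess_le[OF T h, of "1 / real (Suc m)"]
    by (intro nn_integral_PInf_AE borel_measurable_excess[OF T h]) (auto simp: top_unique)
  then have "AE x in M. \<forall>m. excess (1 / real (Suc m)) T h x \<noteq> \<infinity>"
    by (simp add: AE_all_countable)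
  then show ?thesis
  proof (rule eventually_mono)
    fix x assume fin: "\<forall>m. excess (1 / real (Suc m)) T h x \<noteq> \<infinity>"
    let ?Y = "\<lambda>i. norm (h ((T ^^ i) x)) / sqrt (real (Suc i))"
    show "?Y \<longlonglongrightarrow> 0"
    proof (rule LIMSEQ_I)
      fix r :: real assume "0 < r"
      then obtain m where m: "1 / real (Suc m) < r"
        by (metis inverse_eq_divide reals_Archimedean)
      define \<epsilon> where "\<epsilon> = 1 / real (Suc m)"
      have "summable (\<lambda>i. if \<epsilon> * sqrt (real (Suc i)) < norm (h ((T ^^ i) x)) then ?Y i else 0)"
        using fin by (intro summable_suminf_not_top) (auto simp: \<epsilon>_def excess_def)
      then have "\<forall>\<^sub>F i in sequentially. (if \<epsilon> * sqrt (real (Suc i)) < norm (h ((T ^^ i) x)) then ?Y i else 0) < \<epsilon>"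
        by (intro order_tendstoD(2)[OF summable_LIMSEQ_zero]) (auto simp: \<epsilon>_def)
      then have "\<forall>\<^sub>F i in sequentially. ?Y i < r"
      proof (rule eventually_mono)
        fix i assume i: "(if \<epsilon> * sqrt (real (Suc i)) < norm (h ((T ^^ i) x)) then ?Y i else 0) < \<epsilon>"
        have "?Y i \<le> \<epsilon>"
        proof (cases "\<epsilon> * sqrt (real (Suc i)) < norm (h ((T ^^ i) x))")
          case False
          then show ?thesis by (simp add: field_simps del: of_nat_Suc)
        qed (use i in simp)
        with m show "?Y i < r" by (simp add: \<epsilon>_def)
      qed
      then show "\<exists>N. \<forall>n\<ge>N. norm (?Y n - 0) < r"
        by (simp add: eventually_sequentially del: of_nat_Suc)
    qed
  qed
qed

section \<open>Dyadic chaining\<close>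

text \<open>Clearing the binary digits of \<open>n\<close> one after the other leads from \<open>n\<close> to 0. Clearing digit \<open>j\<close>
  changes nothing or moves from \<open>(i + 1) * 2 ^ j\<close> to \<open>i * 2 ^ j\<close> with \<open>(i + 1) * 2 ^ j \<le> n\<close>, and for
  fixed \<open>j\<close> this \<open>i\<close> grows with \<open>n\<close>. Tannery's theorem then allows passing to the limit digit by digit.\<close>

lemma dyadic_chaining_tendsto_0:
  fixes P :: "nat \<Rightarrow> 'b::real_normed_vector" and Y :: "nat \<Rightarrow> nat \<Rightarrow> real"
  assumes P0: "P 0 = 0"
    and incr: "\<And>j i. norm (P (Suc i * 2 ^ j) - P (i * 2 ^ j)) / sqrt (real (Suc i * 2 ^ j)) \<le> Y j i"
    and bound: "\<And>j i. Y j i \<le> s j" and "summable s"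
    and lim: "\<And>j. Y j \<longlonglongrightarrow> 0"
  shows "(\<lambda>n. P n /\<^sub>R sqrt (real n)) \<longlonglongrightarrow> 0"
proof -
  \<comment> \<open>\<open>q n j\<close> is \<open>n\<close> with its lowest \<open>j\<close> binary digits cleared.\<close>
  define q where "q n j = n div 2 ^ j * 2 ^ j" for n j :: nat
  define a where "a j n = norm (P (q n j) - P (q n (Suc j))) / sqrt (real n)" for j n
  have Y0: "0 \<le> Y j i" for j i
    by (rule order_trans[OF _ incr]) simp
  have a0: "0 \<le> a j n" for j n by (simp add: a_def)
  have a_le: "a j n \<le> Y j (2 * (n div 2 ^ Suc j))" for j n
  proof -
    define i where "i = 2 * (n div 2 ^ Suc j)"
    have qS: "q n (Suc j) = i * 2 ^ j" by (simp add: q_def i_def)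
    \<comment> \<open>The last digit of \<open>n div 2 ^ j\<close> decides between the two cases.\<close>
    have "n div 2 ^ j = i + n div 2 ^ j mod 2"
      by (simp add: i_def power_Suc2 div_mult2_eq del: power_Suc)
    then consider "n div 2 ^ j = i" | "n div 2 ^ j = Suc i" by linarith
    then show ?thesis
    proof cases
      case 1
      then have "q n j = i * 2 ^ j" by (simp add: q_def)
      then show ?thesis using Y0 by (simp add: a_def qS)
    next
      case 2
      then have qj: "q n j = Suc i * 2 ^ j" by (simp add: q_def)
      have "q n j \<le> n" by (simp add: q_def)
      have "0 < q n j" using qj by simp
      with \<open>q n j \<le> n\<close> have "a j n \<le> norm (P (q n j) - P (i * 2 ^ j)) / sqrt (real (q n j))"
        unfolding a_def qS by (intro divide_left_mono real_sqrt_le_mono) auto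
      also have "\<dots> = norm (P (Suc i * 2 ^ j) - P (i * 2 ^ j)) / sqrt (real (Suc i * 2 ^ j))"
        by (simp only: qj)
      also have "\<dots> \<le> Y j i" by (rule incr)
      finally show ?thesis by (simp add: i_def)
    qed
  qed
  have a_bound: "a j n \<le> s j" for j n
    using a_le bound by (rule order_trans)
  have a_lim: "a j \<longlonglongrightarrow> 0" for j
  proof (rule tendsto_sandwich[OF _ _ tendsto_const])
    have "filterlim (\<lambda>n::nat. 2 * (n div 2 ^ Suc j)) at_top at_top"
    proof (subst filterlim_at_top, intro allI)
      fix Z :: nat
      show "\<forall>\<^sub>F n::nat in at_top. Z \<le> 2 * (n div 2 ^ Suc j)"
        using eventually_ge_at_top[of "Z * 2 ^ Suc j"]
      proof (rule eventually_mono)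
        fix n assume "Z * 2 ^ Suc j \<le> n"
        then have "Z \<le> n div 2 ^ Suc j"
          by (simp add: less_eq_div_iff_mult_less_eq del: power_Suc)
        then show "Z \<le> 2 * (n div 2 ^ Suc j)" by linarith
      qed
    qed
    then show "(\<lambda>n. Y j (2 * (n div 2 ^ Suc j))) \<longlonglongrightarrow> 0"
      by (rule filterlim_compose[OF lim])
  qed (use a0 a_le in \<open>auto intro!: always_eventually simp del: power_Suc\<close>)
  have lim_sum: "(\<lambda>n. \<Sum>j. a j n) \<longlonglongrightarrow> 0"
  proof -
    have "\<forall>\<^sub>F (j, n) in at_top \<times>\<^sub>F sequentially. norm (a j n) \<le> s j"
      using a_bound a0 by (intro always_eventually) auto
    from tannerys_theorem[OF a_lim this \<open>summable s\<close> sequentially_bot] show ?thesis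
      unfolding suminf_zero by blast
  qed
  have "norm (P n /\<^sub>R sqrt (real n)) \<le> (\<Sum>j. a j n)" for n
  proof -
    \<comment> \<open>Clearing \<open>n\<close> digits leaves 0, because \<open>n < 2 ^ n\<close>.\<close>
    have "(\<Sum>j<n. P (q n j) - P (q n (Suc j))) = P (q n 0) - P (q n n)"
      by (rule sum_lessThan_telescope')
    also have "\<dots> = P n" using P0 by (simp add: q_def)
    finally have "norm (P n) \<le> (\<Sum>j<n. norm (P (q n j) - P (q n (Suc j))))"
      by (metis norm_sum)
    then have "norm (P n /\<^sub>R sqrt (real n)) \<le> (\<Sum>j<n. a j n)"
      by (simp add: a_def divide_right_mono flip: sum_divide_distrib divide_inverse_commute)
    also have "\<dots> \<le> (\<Sum>j. a j n)"
    proof (rule sum_le_suminf)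
      show "summable (\<lambda>j. a j n)"
        by (rule summable_comparison_test'[OF \<open>summable s\<close>, of 0]) (use a_bound a0 in auto)
    qed (auto simp: a0)
    finally show ?thesis .
  qed
  then have "\<forall>\<^sub>F n in sequentially. norm (P n /\<^sub>R sqrt (real n)) \<le> (\<Sum>j. a j n)"
    by (intro always_eventually allI)
  then show ?thesis
    using lim_sum by (rule Lim_null_comparison)
qed

text \<open>The thresholds \<open>\<epsilon> j\<close> enter twice: at level \<open>j\<close> the supremum along the orbit costs \<open>\<epsilon> j\<close> plus an excess of
  integral at most \<open>2 / \<epsilon> j\<close> times the squared norm of the normalised dyadic sum. Both must be summable.\<close>

theorem AE_orbit_sum_div_sqrt_tendsto_0:
  fixes f :: "'a \<Rightarrow> 'b::euclidean_space"
  assumes mp: "measure_preserving_map M \<theta>" and L2: "in_L2 M f"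
    and \<epsilon>: "\<And>j. 0 < \<epsilon> j" "summable \<epsilon>"
    and sum: "summable (\<lambda>j. (L2_norm M (orbit_sum \<theta> f (2 ^ j)))\<^sup>2 / 2 ^ j / \<epsilon> j)"
  shows "AE x in M. (\<lambda>n. orbit_sum \<theta> f n x /\<^sub>R sqrt (real n)) \<longlonglongrightarrow> 0"
proof -
  define h where "h j x = inverse (sqrt (2 ^ j)) *\<^sub>R orbit_sum \<theta> f (2 ^ j) x" for j x
  define T where "T j = \<theta> ^^ (2 ^ j)" for j :: nat
  define Y where "Y x j i = norm (h j ((T j ^^ i) x)) / sqrt (real (Suc i))" for x j i
  have T: "measure_preserving_map M (T j)" for j
    unfolding T_def by (rule measure_preserving_map_funpow[OF mp])
  have h: "in_L2 M (h j)" for j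
    unfolding h_def by (intro in_L2_scaleR in_L2_orbit_sum mp L2)
  have norm_h: "(L2_norm M (h j))\<^sup>2 = (L2_norm M (orbit_sum \<theta> f (2 ^ j)))\<^sup>2 / 2 ^ j" for j
    unfolding h_def L2_norm_scaleR_square by (simp add: power_inverse field_simps)
  have "AE x in M. (\<Sum>j. excess (\<epsilon> j) (T j) (h j) x) \<noteq> \<infinity>"
  proof (rule AE_suminf_finite)
    show "summable (\<lambda>j. 2 * (L2_norm M (h j))\<^sup>2 / \<epsilon> j)"
      using summable_mult[OF sum, of 2] by (simp add: norm_h)
  qed (use \<epsilon> less_imp_le[OF \<epsilon>(1)] in \<open>auto intro!: borel_measurable_excess nn_integral_excess_le T h\<close>)
  moreover have "AE x in M. \<forall>j. Y x j \<longlonglongrightarrow> 0"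
    unfolding Y_def by (intro AE_all_countable[THEN iffD2] allI AE_orbit_div_sqrt_tendsto_0 T h)
  ultimately show ?thesis
  proof eventually_elim
    fix x assume fin: "(\<Sum>j. excess (\<epsilon> j) (T j) (h j) x) \<noteq> \<infinity>" and lim: "\<forall>j. Y x j \<longlonglongrightarrow> 0"
    define z where "z j = enn2real (excess (\<epsilon> j) (T j) (h j) x)" for j
    have "excess (\<epsilon> j) (T j) (h j) x \<le> (\<Sum>j. excess (\<epsilon> j) (T j) (h j) x)" for j
      using sum_le_suminf[of "\<lambda>j. excess (\<epsilon> j) (T j) (h j) x" "{j}"] by simp
    then have z: "excess (\<epsilon> j) (T j) (h j) x = ennreal (z j)" for j
      using fin unfolding z_def by (metis ennreal_enn2real infinity_ennreal_def less_top top_unique)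
    show "(\<lambda>n. orbit_sum \<theta> f n x /\<^sub>R sqrt (real n)) \<longlonglongrightarrow> 0"
    proof (rule dyadic_chaining_tendsto_0[where Y = "Y x"])
      show "orbit_sum \<theta> f 0 x = 0" by (simp add: orbit_sum_def)
      show "Y x j \<longlonglongrightarrow> 0" for j using lim by simp
      show "summable (\<lambda>j. \<epsilon> j + z j)"
        using fin unfolding z
        by (intro summable_add \<epsilon> summable_suminf_not_top) (auto simp: z_def)
      show "Y x j i \<le> \<epsilon> j + z j" for j i
      proof -
        have nonneg: "0 \<le> \<epsilon> j" "0 \<le> z j" by (simp_all add: z_def less_imp_le[OF \<epsilon>(1)])
        have "ennreal (Y x j i) \<le> ennreal (\<epsilon> j) + excess (\<epsilon> j) (T j) (h j) x"
          unfolding Y_def by (intro le_excess \<epsilon>)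
        then have "ennreal (Y x j i) \<le> ennreal (\<epsilon> j + z j)"
          unfolding z ennreal_plus[OF nonneg] .
        then show ?thesis by (subst (asm) ennreal_le_iff) (use nonneg in auto)
      qed
      show "norm (orbit_sum \<theta> f (Suc i * 2 ^ j) x - orbit_sum \<theta> f (i * 2 ^ j) x)
          / sqrt (real (Suc i * 2 ^ j)) \<le> Y x j i" for j i
      proof -
        have "norm (orbit_sum \<theta> f (2 ^ j) ((\<theta> ^^ (i * 2 ^ j)) x)) / (sqrt (real (Suc i)) * sqrt (2 ^ j))
            = Y x j i"
          by (simp add: Y_def h_def T_def funpow_mult mult.commute divide_simps)
        moreover have "sqrt (real (Suc i * 2 ^ j)) = sqrt (real (Suc i)) * sqrt (2 ^ j)"
          by (simp only: of_nat_mult real_sqrt_mult of_nat_power of_nat_numeral)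
        moreover have "Suc i * 2 ^ j = i * 2 ^ j + 2 ^ j" by simp
        ultimately show ?thesis
          unfolding orbit_sum_shift by (metis order_refl)
      qed
    qed
  qed
qed

section \<open>Summation by parts\<close>

text \<open>Abel summation: the term is the increment of \<open>P n / sqrt n\<close> plus \<open>P n\<close> times the decrement of
  \<open>1 / sqrt n\<close>, which is at most \<open>1 / (n * sqrt n)\<close>.\<close>

lemma summable_div_sqrt_by_parts:
  fixes P :: "nat \<Rightarrow> 'b::banach"
  assumes lim: "(\<lambda>n. P n /\<^sub>R sqrt (real n)) \<longlonglongrightarrow> 0"
    and sum: "summable (\<lambda>n. norm (P n) / (real n * sqrt (real n)))"
  shows "summable (\<lambda>n. (P (Suc n) - P n) /\<^sub>R sqrt (real (Suc n)))"
proof -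
  let ?r = "\<lambda>n. inverse (sqrt (real n)) - inverse (sqrt (real (Suc n)))"
  have "summable (\<lambda>n. ?r n *\<^sub>R P n)"
  proof (rule summable_comparison_test'[OF sum, of 1])
    fix n :: nat assume n: "1 \<le> n"
    define u v where "u = sqrt (real n)" and "v = sqrt (real (Suc n))"
    have uv: "0 < u" "u \<le> v" "u * u = real n" "v * v = real n + 1" "0 < n"
      using n by (auto simp: u_def v_def)
    have "(v - u) * u \<le> (v - u) * (v + u)"
      using uv by (intro mult_left_mono) auto
    also have "\<dots> = 1" using uv by (simp add: algebra_simps)
    finally have "v - u \<le> 1 / u" using uv by (simp add: field_simps)
    have "inverse u - inverse v = (v - u) / (u * v)" using uv by (simp add: field_simps)
    also have "\<dots> \<le> (1 / u) / (u * u)"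
      using uv \<open>v - u \<le> 1 / u\<close> by (intro frac_le mult_left_mono) auto
    also have "\<dots> = 1 / (real n * u)" using uv by simp
    finally have "?r n \<le> 1 / (real n * sqrt (real n))" by (simp only: u_def v_def)
    moreover have "0 \<le> ?r n" using n by simp
    ultimately show "norm (?r n *\<^sub>R P n) \<le> norm (P n) / (real n * sqrt (real n))"
      using mult_right_mono[of "?r n" "1 / (real n * sqrt (real n))" "norm (P n)"] by simp
  qed
  from summable_add[OF telescope_summable[OF lim] this]
  show ?thesis by (simp add: algebra_simps)
qed

theorem theorem4p3:
  fixes M :: "'a measure" and \<theta> :: "'a \<Rightarrow> 'a"
    and f :: "'a \<Rightarrow> 'b::{real_normed_field, euclidean_space}" and \<delta> :: real
  assumes "measure_preserving_map M \<theta>"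
    and "in_L2 M f"
    and "\<delta> > 1"
    and "(\<lambda>n::nat. ln (real n) * (ln (ln (real n))) powr \<delta> * (L2_norm M (orbit_sum \<theta> f n))\<^sup>2
            / (real n)\<^sup>2) summable_on {3..}"
  shows "(AE x in M. (\<lambda>n. orbit_sum \<theta> f n x /\<^sub>R sqrt (real n)) \<longlonglongrightarrow> 0)
       \<and> (AE x in M. summable (\<lambda>n. f ((\<theta> ^^ Suc n) x) /\<^sub>R sqrt (real (Suc n))))"
proof -
  let ?w = "log_weight \<delta>" and ?S = "orbit_sum \<theta> f"
  define c where "c n = ?w n * (L2_norm M (?S n))\<^sup>2 / (real n)\<^sup>2" for n
  have c0: "0 \<le> c n" for n by (simp add: c_def log_weight_nonneg)
  have "c summable_on {3..} \<union> {..<3}"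
    using assms(4) by (intro summable_on_Un_disjoint) (auto simp: c_def[abs_def] log_weight_def)
  moreover have "{3..} \<union> {..<3} = (UNIV :: nat set)" by auto
  ultimately have c: "summable c" by (metis summable_on_imp_summable)

  have "summable (\<lambda>j. ?w (2 ^ j) * ((L2_norm M (?S (2 ^ j)))\<^sup>2 / 2 ^ j))"
    using c assms(1-3) unfolding c_def
    by (intro summable_dyadic_L2_norm[where N = 3]) (auto intro: log_weight_mono log_weight_nonneg)
  \<comment> \<open>\<open>?w 1\<close> is 0 and \<open>?w 2\<close> involves a power of the negative number \<open>ln (ln 2)\<close>, so the first two
    thresholds are set to 1.\<close>
  define \<epsilon> where "\<epsilon> j = (if j < 2 then 1 else 1 / ?w (2 ^ j))" for j
  have four: "4 \<le> (2::nat) ^ j" if "j \<ge> 2" for j :: nat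
    using power_increasing[OF that, of "2::nat"] by simp
  have eps: "0 < \<epsilon> j" for j
    using four[of j] by (auto simp: \<epsilon>_def intro!: log_weight_pos)
  have "summable \<epsilon>"
    by (rule summable_comparison_test'[OF summable_inverse_log_weight_dyadic[OF assms(3)], of 2])
       (auto simp: \<epsilon>_def log_weight_nonneg)
  moreover have "summable (\<lambda>j. (L2_norm M (?S (2 ^ j)))\<^sup>2 / 2 ^ j / \<epsilon> j)"
    by (rule summable_comparison_test'[OF \<open>summable (\<lambda>j. ?w (2 ^ j) * _ j)\<close>, of 2])
       (auto simp: \<epsilon>_def log_weight_nonneg abs_mult mult.commute)
  ultimately have first: "AE x in M. (\<lambda>n. ?S n x /\<^sub>R sqrt (real n)) \<longlonglongrightarrow> 0"
    using assms(1,2) eps by (intro AE_orbit_sum_div_sqrt_tendsto_0[where \<epsilon> = \<epsilon>])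

  have L2S: "in_L2 M (?S n)" for n
    by (rule in_L2_orbit_sum[OF assms(1,2)])
  then have [measurable]: "?S n \<in> borel_measurable M" for n
    by (simp add: in_L2_def)
  have "AE x in M. (\<Sum>n. ennreal (?w n / (real n)\<^sup>2 * (norm (?S n x))\<^sup>2)) \<noteq> \<infinity>"
  proof (rule AE_suminf_finite[OF _ _ c c0])
    fix n
    have "(\<integral>\<^sup>+x. ennreal (?w n / (real n)\<^sup>2 * (norm (?S n x))\<^sup>2) \<partial>M)
        = (\<integral>\<^sup>+x. ennreal (?w n / (real n)\<^sup>2) * ennreal ((norm (?S n x))\<^sup>2) \<partial>M)"
      by (intro nn_integral_cong ennreal_mult) (auto simp: log_weight_nonneg)
    also have "\<dots> = ennreal (?w n / (real n)\<^sup>2) * ennreal ((L2_norm M (?S n))\<^sup>2)"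
      by (subst nn_integral_cmult) (simp_all add: nn_integral_norm_square[OF L2S])
    finally show "(\<integral>\<^sup>+x. ennreal (?w n / (real n)\<^sup>2 * (norm (?S n x))\<^sup>2) \<partial>M) \<le> ennreal (c n)"
      by (simp add: c_def log_weight_nonneg flip: ennreal_mult)
  qed measurable
  with first have "AE x in M. summable (\<lambda>n. f ((\<theta> ^^ Suc n) x) /\<^sub>R sqrt (real (Suc n)))"
  proof eventually_elim
    fix x assume lim: "(\<lambda>n. ?S n x /\<^sub>R sqrt (real n)) \<longlonglongrightarrow> 0"
      and fin: "(\<Sum>n. ennreal (?w n / (real n)\<^sup>2 * (norm (?S n x))\<^sup>2)) \<noteq> \<infinity>"
    have "summable (\<lambda>n. ?w n / (real n)\<^sup>2 * (norm (?S n x))\<^sup>2)"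
      using fin by (intro summable_suminf_not_top) (auto simp: log_weight_nonneg)
    from summable_add[OF this summable_inverse_log_weight[OF assms(3)]]
    have "summable (\<lambda>n. norm (?S n x) / (real n * sqrt (real n)))"
    proof (rule summable_comparison_test'[where N = 3])
      fix n :: nat assume n: "3 \<le> n"
      \<comment> \<open>The term is the product \<open>u * v\<close>, whose factors are chosen so that \<open>u\<^sup>2\<close> and \<open>v\<^sup>2\<close> are the terms
        of the two convergent series.\<close>
      define u v where "u = sqrt (?w n) * norm (?S n x) / real n" and "v = 1 / sqrt (real n * ?w n)"
      have "0 < ?w n" using n by (rule log_weight_pos)
      have "u * v = norm (?S n x) / (real n * sqrt (real n))"
        using \<open>0 < ?w n\<close> n by (simp add: u_def v_def real_sqrt_mult)
      moreover have "0 \<le> u * v" using \<open>0 < ?w n\<close> by (simp add: u_def v_def)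
      then have "u * v \<le> u\<^sup>2 + v\<^sup>2"
        using zero_le_power2[of "u - v"] by (simp add: power2_eq_square algebra_simps)
      moreover have "u\<^sup>2 = ?w n / (real n)\<^sup>2 * (norm (?S n x))\<^sup>2" "v\<^sup>2 = 1 / (real n * ?w n)"
        using \<open>0 < ?w n\<close> by (simp_all add: u_def v_def power_mult_distrib power_divide)
      ultimately show "norm (norm (?S n x) / (real n * sqrt (real n)))
          \<le> ?w n / (real n)\<^sup>2 * (norm (?S n x))\<^sup>2 + 1 / (real n * ?w n)"
        by simp
    qed
    from summable_div_sqrt_by_parts[OF lim this]
    show "summable (\<lambda>n. f ((\<theta> ^^ Suc n) x) /\<^sub>R sqrt (real (Suc n)))"
      by (simp add: orbit_sum_def)
  qed
  with first show ?thesis by blast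
qed

end
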